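(* Let $l\ge 1$ and let $d_1,\dots,d_l$ be nonnegative integers with $d=d_1+\cdots+d_l\ge 1$. For $1\le k\le d$ let ${\mathbf{d}\brace k}_O$ denote the number of ordered partitions of the multiset $S(\mathbf{d})$ into $k$ nonempty multisets. Then, as an identity of polynomials in $x$, $$\prod_{j=1}^l\binom{x+d_j}{d_j}=\sum_{k=1}^d{\mathbf{d}\brace k}_O\binom{x+1}{k}.$$
   Context: For $\mathbf{d}=(d_1,\dots,d_l)$, $S(\mathbf{d})$ is the multiset containing $j$ with multiplicity $d_j$ for each $j\in\{1,\dots,l\}$. An ordered partition of $S(\mathbf{d})$ into $k$ nonempty multisets is a sequence $(S_1,\dots,S_k)$ of nonempty submultisets whose multiset union (sum of multiplicities) is $S(\mathbf{d})$; equivalently, a sequence of vectors $\mathbf{0}=\mathbf{v}_0<\mathbf{v}_1<\cdots<\mathbf{v}_k=(d_1,\dots,d_l)$ in $\mathbb{Z}_{\ge0}^l$ strictly increasing in the componentwise partial order (with $\mathbf{v}_{h}\neq\mathbf{v}_{h+1}$). When all $d_j=1$, ${\mathbf{d}\brace k}_O=k!{l\brace k}$. *)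

theory Defs
  imports Complex_Main "HOL-Library.Multiset" "HOL-Computational_Algebra.Polynomial"
begin

definition S_mset :: "nat \<Rightarrow> (nat \<Rightarrow> nat) \<Rightarrow> nat multiset" where
  "S_mset l d = (\<Sum>j = 1..l. replicate_mset (d j) j)"

lemma count_S_mset: "count (S_mset l d) j = (if j \<in> {1..l} then d j else 0)"
  by (simp add: S_mset_def count_sum)

definition ordered_partitions :: "'a multiset \<Rightarrow> nat \<Rightarrow> 'a multiset list set" where
  "ordered_partitions M k = {Ps. length Ps = k \<and> (\<forall>P\<in>set Ps. P \<noteq> {#}) \<and> sum_list Ps = M}"

lemma finite_submultisets: "finite {P. P \<subseteq># M}"
proof (induction M)
  case empty
  then show ?case by simp
next
  case (add x M)
  have "P \<in> {P. P \<subseteq># M} \<union> add_mset x ` {P. P \<subseteq># M}" if "P \<subseteq># add_mset x M" for P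
  proof (cases "x \<in># P")
    case True
    then have "P = add_mset x (P - {#x#})"
      by simp
    moreover from this that have "P - {#x#} \<subseteq># M"
      by (simp add: subset_eq_diff_conv)
    ultimately show ?thesis by blast
  next
    case False
    have "P \<subseteq># M"
    proof (rule mset_subset_eqI)
      fix y
      show "count P y \<le> count M y"
        using mset_subset_eq_count[OF that, of y] False
        by (cases "y = x") (auto simp: not_in_iff)
    qed
    then show ?thesis by blast
  qed
  then have "{P. P \<subseteq># add_mset x M} \<subseteq> {P. P \<subseteq># M} \<union> add_mset x ` {P. P \<subseteq># M}"
    by blast
  with add.IH show ?case
    by (meson finite_UnI finite_imageI finite_subset)
qed

text \<open>Finiteness ensures that the cardinality below is a genuine count.\<close>

lemma finite_ordered_partitions: "finite (ordered_partitions M k)"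
proof -
  have "P \<subseteq># sum_list Ps" if "P \<in> set Ps" for P and Ps :: "'a multiset list"
    using that by (induction Ps) (auto intro: subset_mset.order_trans)
  then have "ordered_partitions M k \<subseteq> {Ps. set Ps \<subseteq> {P. P \<subseteq># M} \<and> length Ps = k}"
    by (auto simp: ordered_partitions_def)
  then show ?thesis
    by (rule finite_subset) (intro finite_lists_length_eq finite_submultisets)
qed

definition num_ordered_partitions :: "nat \<Rightarrow> (nat \<Rightarrow> nat) \<Rightarrow> nat \<Rightarrow> nat" where
  "num_ordered_partitions l d k = card (ordered_partitions (S_mset l d) k)"

text \<open>
  The binomial coefficient of a polynomial \<open>p\<close> over \<open>k\<close>, that is
  \<open>p (p - 1) \<dots> (p - k + 1) / k!\<close>.
\<close>

definition binom_poly :: "'a::field_char_0 poly \<Rightarrow> nat \<Rightarrow> 'a poly" where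
  "binom_poly p k = smult (1 / fact k) (\<Prod>i<k. p - of_nat i)"

lemma poly_binom_poly: "poly (binom_poly p k) a = poly p a gchoose k"
  by (simp add: binom_poly_def gbinomial_prod_rev poly_prod atLeast0LessThan)

end

theory Submission
  imports Defs
begin

text \<open>
  At \<open>x = n\<close> both sides count the sequences of \<open>n + 1\<close> possibly empty multisets with sum
  \<open>S(d)\<close>. Distributing the copies of each \<open>j\<close> independently gives the product of binomial
  coefficients; choosing which \<open>k\<close> of the \<open>n + 1\<close> positions are nonempty gives the sum over
  \<open>k\<close>. Two polynomials that agree at all naturals are equal.
\<close>

definition weak_ordered_partitions :: "'a multiset \<Rightarrow> nat \<Rightarrow> 'a multiset list set" where
  "weak_ordered_partitions M m = {Ps. length Ps = m \<and> sum_list Ps = M}"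

lemma finite_lists_sum_mset: "finite {Ps. length Ps = k \<and> Q Ps \<and> sum_list Ps = (M :: 'a multiset)}"
proof -
  have "P \<subseteq># sum_list Ps" if "P \<in> set Ps" for P and Ps :: "'a multiset list"
    using that by (induction Ps) (auto intro: subset_mset.order_trans)
  then have "{Ps. length Ps = k \<and> Q Ps \<and> sum_list Ps = M} \<subseteq>
      {Ps. set Ps \<subseteq> {P. P \<subseteq># M} \<and> length Ps = k}"
    by auto
  then show ?thesis
    by (rule finite_subset) (intro finite_lists_length_eq finite_submultisets)
qed

text \<open>Splitting off the first entry \<open>P\<close> leaves a shorter list with sum
  \<open>M - P\<close>. The predicate \<open>A\<close> lets one recursion serve both the ordered
  partitions (\<open>A\<close> is nonemptiness) and the weak ones (\<open>A\<close> is always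
  true).\<close>

lemma card_lists_sum_mset_Suc:
  fixes M :: "'a multiset"
  shows "card {Ps. length Ps = Suc k \<and> (\<forall>P\<in>set Ps. A P) \<and> sum_list Ps = M} =
    (\<Sum>P | P \<subseteq># M \<and> A P. card {Ps. length Ps = k \<and> (\<forall>P\<in>set Ps. A P) \<and> sum_list Ps = M - P})"
    (is "card (?L (Suc k) M) = (\<Sum>P\<in>?S. card (?L k (M - P)))")
proof -
  have fin: "finite ?S"
    using finite_submultisets[of M] by (rule rev_finite_subset) auto
  have "?L (Suc k) M = (\<lambda>(P, Ps). P # Ps) ` (SIGMA P:?S. ?L k (M - P))"
  proof (intro equalityI subsetI)
    fix Ps assume "Ps \<in> ?L (Suc k) M"
    then show "Ps \<in> (\<lambda>(P, Ps). P # Ps) ` (SIGMA P:?S. ?L k (M - P))"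
      by (cases Ps) (auto simp: image_iff)
  qed auto
  moreover have "inj_on (\<lambda>(P, Ps). P # Ps) (SIGMA P:?S. ?L k (M - P))"
    by (auto simp: inj_on_def)
  ultimately have "card (?L (Suc k) M) = card (SIGMA P:?S. ?L k (M - P))"
    by (simp add: card_image)
  also have "\<dots> = (\<Sum>P\<in>?S. card (?L k (M - P)))"
    using fin by (intro card_SigmaI) (simp_all add: finite_lists_sum_mset)
  finally show ?thesis .
qed

lemma card_ordered_partitions_Suc:
  "card (ordered_partitions M (Suc k)) =
    (\<Sum>P | P \<subseteq># M \<and> P \<noteq> {#}. card (ordered_partitions (M - P) k))"
  unfolding ordered_partitions_def by (rule card_lists_sum_mset_Suc)

text \<open>The case of an empty first entry is isolated so that the remaining sum has the same
  index set as in \<open>card_ordered_partitions_Suc\<close>.\<close>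

lemma card_weak_ordered_partitions_Suc:
  "card (weak_ordered_partitions M (Suc m)) =
    card (weak_ordered_partitions M m) +
    (\<Sum>P | P \<subseteq># M \<and> P \<noteq> {#}. card (weak_ordered_partitions (M - P) m))"
proof -
  have "card (weak_ordered_partitions M (Suc m)) =
      (\<Sum>P | P \<subseteq># M. card (weak_ordered_partitions (M - P) m))"
    using card_lists_sum_mset_Suc[of m "\<lambda>_. True" M] by (simp add: weak_ordered_partitions_def)
  also have "{P. P \<subseteq># M} = insert {#} {P. P \<subseteq># M \<and> P \<noteq> {#}}"
    by auto
  also have "(\<Sum>P\<in>\<dots>. card (weak_ordered_partitions (M - P) m)) =
      card (weak_ordered_partitions M m) +
      (\<Sum>P | P \<subseteq># M \<and> P \<noteq> {#}. card (weak_ordered_partitions (M - P) m))"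
    by (subst sum.insert) (auto intro: rev_finite_subset[OF finite_submultisets[of M]])
  finally show ?thesis .
qed

text \<open>The choice of the nonempty positions is never made explicit: both sides satisfy the same
  recursion in \<open>m\<close>, on the right by Pascal's rule. The first entry changes the
  multiset, so \<open>M\<close> must stay arbitrary in the induction.\<close>

lemma card_weak_ordered_partitions_eq_sum:
  "card (weak_ordered_partitions M m) = (\<Sum>k\<le>m. (m choose k) * card (ordered_partitions M k))"
proof (induction m arbitrary: M)
  case 0
  then show ?case
    by (simp add: weak_ordered_partitions_def ordered_partitions_def cong: conj_cong)
next
  case (Suc m)
  let ?S = "{P. P \<subseteq># M \<and> P \<noteq> {#}}"
  let ?p = "\<lambda>k. card (ordered_partitions M k)"
  have "(\<Sum>P\<in>?S. card (weak_ordered_partitions (M - P) m)) =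
      (\<Sum>k\<le>m. (m choose k) * ?p (Suc k))"
    unfolding Suc.IH card_ordered_partitions_Suc sum_distrib_left by (rule sum.swap)
  moreover have "(\<Sum>k\<le>Suc m. (Suc m choose k) * ?p k) =
      (\<Sum>k\<le>m. (m choose k) * ?p k) + (\<Sum>k\<le>m. (m choose k) * ?p (Suc k))"
  proof -
    \<comment> \<open>With the term for 0 split off, Pascal's rule applies to each
      \<open>Suc m choose Suc k\<close>.\<close>
    have "(\<Sum>k\<le>Suc m. (Suc m choose k) * ?p k) =
        ?p 0 + (\<Sum>k\<le>m. (m choose Suc k) * ?p (Suc k)) + (\<Sum>k\<le>m. (m choose k) * ?p (Suc k))"
      by (subst sum.atMost_Suc_shift) (simp add: algebra_simps sum.distrib)
    also have "?p 0 + (\<Sum>k\<le>m. (m choose Suc k) * ?p (Suc k)) = (\<Sum>k\<le>Suc m. (m choose k) * ?p k)"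
      by (subst sum.atMost_Suc_shift) simp
    \<comment> \<open>The top term vanishes because \<open>m choose Suc m\<close> is 0.\<close>
    also have "\<dots> = (\<Sum>k\<le>m. (m choose k) * ?p k)"
      by simp
    finally show ?thesis .
  qed
  ultimately show ?case
    by (simp add: card_weak_ordered_partitions_Suc Suc.IH)
qed

text \<open>The copies of \<open>a\<close> are distributed independently of the rest:
  \<open>?f\<close> splits every entry into its part without \<open>a\<close> and its number of
  copies of \<open>a\<close>, and \<open>?g\<close> merges the two again.\<close>

lemma card_weak_ordered_partitions_add_replicate:
  assumes "a \<notin># M"
  shows "card (weak_ordered_partitions (M + replicate_mset n a) m) =
    card (weak_ordered_partitions M m) * card {ns :: nat list. length ns = m \<and> sum_list ns = n}"
proof -
  let ?N = "{ns :: nat list. length ns = m \<and> sum_list ns = n}"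
  let ?f = "\<lambda>Ps. (map (filter_mset (\<lambda>x. x \<noteq> a)) Ps, map (\<lambda>P. count P a) Ps)"
  let ?g = "\<lambda>(Qs, ns). map2 (\<lambda>Q k. Q + replicate_mset k a) Qs ns"
  have filter_sum: "sum_list (map (filter_mset (\<lambda>x. x \<noteq> a)) Ps) =
      filter_mset (\<lambda>x. x \<noteq> a) (sum_list Ps)" for Ps
    by (induction Ps) auto
  have count_sum: "sum_list (map (\<lambda>P. count P a) Ps) = count (sum_list Ps) a" for Ps
    by (induction Ps) auto
  have split: "filter_mset (\<lambda>x. x \<noteq> a) P + replicate_mset (count P a) a = P" for P
    by (rule multiset_eqI) auto
  have gf: "?g (?f Ps) = Ps" for Ps
    by (induction Ps) (auto simp: split)
  have filter_M: "filter_mset (\<lambda>x. x \<noteq> a) M = M"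
    using assms by (auto simp: filter_mset_eq_conv)
  have filter_add: "filter_mset (\<lambda>x. x \<noteq> a) (Q + replicate_mset k a) = Q"
    if "count Q a = 0" for Q k
    using that by (auto simp: multiset_eq_iff)
  have filter_g: "map (filter_mset (\<lambda>x. x \<noteq> a)) (?g (Qs, ns)) = Qs"
    and count_g: "map (\<lambda>P. count P a) (?g (Qs, ns)) = ns"
    if "length Qs = length ns" "\<forall>Q\<in>set Qs. a \<notin># Q" for Qs ns
    using that
    by (induction Qs ns rule: list_induct2)
      (auto simp: filter_add not_in_iff simp del: filter_union_mset)
  have sum_g: "sum_list (?g (Qs, ns)) = sum_list Qs + replicate_mset (sum_list ns) a"
    if "length Qs = length ns" for Qs ns
    using that
    by (induction Qs ns rule: list_induct2) (auto simp: multiset_eq_iff)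
  \<comment> \<open>Recovering \<open>(Qs, ns)\<close> from \<open>?g (Qs, ns)\<close> requires
    entries free of \<open>a\<close>; this is inherited from their sum \<open>M\<close>.\<close>
  have notin: "\<forall>Q\<in>set Qs. a \<notin># Q" if "sum_list Qs = M" for Qs
  proof -
    have "count (sum_list Qs) a = 0 \<longleftrightarrow> (\<forall>Q\<in>set Qs. a \<notin># Q)"
      by (induction Qs) (auto simp: not_in_iff)
    with assms that show ?thesis
      by (simp add: not_in_iff)
  qed
  have "bij_betw ?f (weak_ordered_partitions (M + replicate_mset n a) m)
      (weak_ordered_partitions M m \<times> ?N)"
  proof (rule bij_betw_byWitness[where f' = ?g])
    show "\<forall>z\<in>weak_ordered_partitions M m \<times> ?N. ?f (?g z) = z"
      using filter_g count_g notin by (auto simp: weak_ordered_partitions_def simp del: map_map)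
    show "?f ` weak_ordered_partitions (M + replicate_mset n a) m \<subseteq> weak_ordered_partitions M m \<times> ?N"
      using assms
      by (auto simp: weak_ordered_partitions_def filter_sum count_sum filter_M not_in_iff
          filter_mset_eq_conv)
    show "?g ` (weak_ordered_partitions M m \<times> ?N) \<subseteq> weak_ordered_partitions (M + replicate_mset n a) m"
      using sum_g by (auto simp: weak_ordered_partitions_def)
  qed (use gf in auto)
  then show ?thesis
    by (simp add: bij_betw_same_card card_cartesian_product)
qed

text \<open>Adding one letter at a time, the letter \<open>j\<close> contributes by stars and bars
  the number of ways to write \<open>d j\<close> as an ordered sum of \<open>Suc n\<close> naturals.
  Using \<open>Suc n\<close> positions avoids a truncated subtraction in the binomial
  coefficient.\<close>

lemma card_weak_ordered_partitions_S_mset: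
  "card (weak_ordered_partitions (S_mset l d) (Suc n)) = (\<Prod>j = 1..l. (n + d j) choose d j)"
proof (induction l)
  case 0
  have "weak_ordered_partitions {#} (Suc n) = {replicate (Suc n) ({#} :: nat multiset)}"
  proof -
    have "sum_list Ps = {#} \<longleftrightarrow> (\<forall>P\<in>set Ps. P = {#})" for Ps :: "nat multiset list"
      by (induction Ps) auto
    then show ?thesis
      unfolding weak_ordered_partitions_def by (auto intro: replicate_eqI simp del: replicate_Suc)
  qed
  then show ?case
    by (simp add: S_mset_def)
next
  case (Suc l)
  have "S_mset (Suc l) d = S_mset l d + replicate_mset (d (Suc l)) (Suc l)"
    by (simp add: S_mset_def)
  moreover have "Suc l \<notin># S_mset l d"
    by (simp add: not_in_iff count_S_mset)
  ultimately show ?case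
    by (simp add: card_weak_ordered_partitions_add_replicate Suc.IH card_length_sum_list add.commute)
qed

lemma ordered_partitions_0: "M \<noteq> {#} \<Longrightarrow> ordered_partitions M 0 = {}"
  by (auto simp: ordered_partitions_def)

text \<open>Each nonempty entry contributes at least 1 to the size of the sum.\<close>

lemma ordered_partitions_eq_empty:
  assumes "size M < k"
  shows "ordered_partitions M k = {}"
proof -
  have "length Ps \<le> size (sum_list Ps)" if "\<forall>P\<in>set Ps. P \<noteq> {#}" for Ps :: "'a multiset list"
    using that
  proof (induction Ps)
    case (Cons P Ps)
    then have "size P \<ge> 1"
      by (simp add: Suc_le_eq nonempty_has_size)
    with Cons show ?case
      by simp
  qed simp
  with assms show ?thesis
    by (fastforce simp: ordered_partitions_def)
qed

lemma card_weak_ordered_partitions_nonempty: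
  assumes "M \<noteq> {#}"
  shows "card (weak_ordered_partitions M m) =
    (\<Sum>k = 1..size M. (m choose k) * card (ordered_partitions M k))"
proof -
  \<comment> \<open>The bound \<open>m + size M\<close> covers both ranges, so \<open>m\<close> and
    \<open>size M\<close> need not be compared. The terms added here have \<open>k > m\<close> and a
    zero binomial coefficient; those removed next have \<open>k = 0\<close> or
    \<open>k > size M\<close> and no partitions.\<close>
  have "(\<Sum>k\<le>m. (m choose k) * card (ordered_partitions M k)) =
      (\<Sum>k\<le>m + size M. (m choose k) * card (ordered_partitions M k))"
    by (rule sum.mono_neutral_left) auto
  also have "\<dots> = (\<Sum>k = 1..size M. (m choose k) * card (ordered_partitions M k))"
    by (rule sum.mono_neutral_right)
      (auto simp: ordered_partitions_0[OF assms] ordered_partitions_eq_empty not_le Suc_le_eq)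
  finally show ?thesis
    by (simp add: card_weak_ordered_partitions_eq_sum)
qed

text \<open>Otherwise \<open>p - q\<close> would be a nonzero polynomial with infinitely many roots,
  the naturals being distinct in characteristic 0.\<close>

lemma poly_eq_if_eq_on_of_nat:
  fixes p q :: "'a::{idom, ring_char_0} poly"
  assumes "\<And>n :: nat. poly p (of_nat n) = poly q (of_nat n)"
  shows "p = q"
proof (rule ccontr)
  assume "p \<noteq> q"
  then have "finite {x. poly (p - q) x = 0}"
    by (intro poly_roots_finite) simp
  moreover have "range of_nat \<subseteq> {x. poly (p - q) x = 0}"
    using assms by auto
  moreover have "infinite (range (of_nat :: nat \<Rightarrow> 'a))"
    by (simp add: inj_of_nat range_inj_infinite)
  ultimately show False
    using finite_subset by blast
qed

theorem theorem4:
  fixes l :: nat and d :: "nat \<Rightarrow> nat"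
  assumes "l \<ge> 1"
    and "(\<Sum>j = 1..l. d j) \<ge> 1"
  shows "(\<Prod>j = 1..l. binom_poly ([:0, 1:] + of_nat (d j)) (d j)) =
         (\<Sum>k = 1..(\<Sum>j = 1..l. d j).
            of_nat (num_ordered_partitions l d k) *
            binom_poly ([:0, 1:] + 1 :: 'a::field_char_0 poly) k)"
proof (rule poly_eq_if_eq_on_of_nat)
  fix n :: nat
  have size: "size (S_mset l d) = (\<Sum>j = 1..l. d j)"
    by (simp add: S_mset_def)
  with assms(2) have "S_mset l d \<noteq> {#}"
    by auto
  then have count: "(\<Prod>j = 1..l. (n + d j) choose d j) =
      (\<Sum>k = 1..(\<Sum>j = 1..l. d j). (Suc n choose k) * num_ordered_partitions l d k)"
    unfolding card_weak_ordered_partitions_S_mset[symmetric] num_ordered_partitions_def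
      size[symmetric]
    by (rule card_weak_ordered_partitions_nonempty)
  \<comment> \<open>Used with \<open>i = d j\<close> for the product and with \<open>i = 1\<close>
    for the sum, where \<open>x + 1\<close> takes the value \<open>Suc n\<close>, the number of
    positions.\<close>
  have choose: "(of_nat n + of_nat i :: 'a) gchoose k = of_nat ((n + i) choose k)" for i k
    by (simp add: binomial_gbinomial)
  have "poly (\<Prod>j = 1..l. binom_poly ([:0, 1:] + of_nat (d j)) (d j)) (of_nat n :: 'a) =
      of_nat (\<Prod>j = 1..l. (n + d j) choose d j)"
    by (simp add: poly_prod poly_binom_poly choose)
  also have "\<dots> = poly (\<Sum>k = 1..(\<Sum>j = 1..l. d j).
      of_nat (num_ordered_partitions l d k) * binom_poly ([:0, 1:] + 1) k) (of_nat n)"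
    unfolding count using choose[of 1] by (simp add: poly_sum poly_binom_poly mult.commute)
  finally show "poly (\<Prod>j = 1..l. binom_poly ([:0, 1:] + of_nat (d j)) (d j)) (of_nat n :: 'a) =
      poly (\<Sum>k = 1..(\<Sum>j = 1..l. d j).
      of_nat (num_ordered_partitions l d k) * binom_poly ([:0, 1:] + 1) k) (of_nat n)" .
qed

end
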